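(* Let $n\ge0$. (a) The map $$\tilde{\mathrm d}_{\mathrm{LS}}:\overline{\mathrm{Nil}}(\mathfrak{sp}_{2n}(\mathbb C))\to\overline{\mathrm{Nil}}^{\mathrm{sp}}(\mathfrak o_{2n}(\mathbb C)),\qquad \mathbf d\mapsto\text{the D-collapse of }\mathbf d^{\mathrm t},$$ is well-defined (in particular its values are special), surjective, and order reversing. (b) The map $$\tilde{\mathrm d}_{\mathrm{SP}}:\overline{\mathrm{Nil}}^{\mathrm{sp}}(\mathfrak o_{2n}(\mathbb C))\to\overline{\mathrm{Nil}}^{\mathrm{ms}}(\mathfrak{sp}_{2n}(\mathbb C)^* ),\qquad \mathbf d\mapsto\text{the C-collapse of }(\mathbf d^+)^-,$$ is well-defined (in particular its values are metaplectic special), bijective, and order preserving.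
   Context: Nilpotent orbits are identified with Young diagrams (rows = Jordan block sizes). $\overline{\mathrm{Nil}}(\mathfrak{sp}_{2n}(\mathbb C))$ is the set of nilpotent $\mathrm{Sp}_{2n}(\mathbb C)$-orbits, identified with Young diagrams of type C: size $2n$, each odd row length occurring an even number of times. $\overline{\mathrm{Nil}}(\mathfrak o_{2n}(\mathbb C))$ is the set of nilpotent orbits under the full group $\mathrm O_{2n}(\mathbb C)$, identified with Young diagrams of type D: size $2n$, each even row length occurring an even number of times. $\mathfrak{sp}_{2n}(\mathbb C)^*$ is identified with $\mathfrak{sp}_{2n}(\mathbb C)$ via half the trace form. The order is the dominance order on Young diagrams. For a Young diagram $\mathbf d$: $\mathbf d^{\mathrm t}$ is the transpose; $\mathbf d^+$ is obtained by adding one box to the first row; $\mathbf d^-$ ($\mathbf d$ nonempty) is obtained by removing one box from the last row. The C-collapse (resp. D-collapse) of a Young diagram of size $2n$ is the unique largest Young diagram of type C (resp. D) of size $2n$ dominated by it. The superscript sp denotes special orbits (in the sense of Lusztig): a type D orbit is special if and only if the transpose of its Young diagram is of type C. The superscript ms denotes metaplectic special orbits: a type C orbit is metaplectic special if the transpose of its Young diagram is of type D. *)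

theory Defs
  imports Main
begin

text \<open>
  A Young diagram is the weakly decreasing list of its (positive) row lengths; nilpotent orbits
  are identified with the Young diagrams recording their Jordan block sizes.
\<close>

definition young_diagram :: "nat list \<Rightarrow> bool" where
  "young_diagram d \<longleftrightarrow> sorted_wrt (\<ge>) d \<and> 0 \<notin> set d"

text \<open>
  For \<open>k\<close> beyond the number of rows, \<open>take k\<close> gives all rows, so the partial sums are those of
  the row lengths padded by zeros.
\<close>

definition dominated :: "nat list \<Rightarrow> nat list \<Rightarrow> bool"  (infix "\<unlhd>" 50) where
  "c \<unlhd> d \<longleftrightarrow> sum_list c = sum_list d \<and> (\<forall>k. sum_list (take k c) \<le> sum_list (take k d))"

definition yd_transpose :: "nat list \<Rightarrow> nat list" where
  "yd_transpose d =
     (case d of [] \<Rightarrow> [] | r # _ \<Rightarrow> map (\<lambda>j. length (filter (\<lambda>x. j < x) d)) [0..<r])"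

definition add_box_first :: "nat list \<Rightarrow> nat list" where
  "add_box_first d = (case d of [] \<Rightarrow> [1] | r # rs \<Rightarrow> (r + 1) # rs)"

text \<open>Only meaningful for nonempty diagrams; a last row of length one disappears.\<close>

definition remove_box_last :: "nat list \<Rightarrow> nat list" where
  "remove_box_last d = (if last d = 1 then butlast d else butlast d @ [last d - 1])"

definition type_C :: "nat list \<Rightarrow> bool" where
  "type_C d \<longleftrightarrow> young_diagram d \<and> even (sum_list d) \<and> (\<forall>r. odd r \<longrightarrow> even (count_list d r))"

text \<open>
  Zero is an even number, but there are no rows of length zero, so its count is zero.
\<close>

definition type_D :: "nat list \<Rightarrow> bool" where
  "type_D d \<longleftrightarrow> young_diagram d \<and> even (sum_list d) \<and> (\<forall>r. even r \<longrightarrow> even (count_list d r))"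

text \<open>
  Since \<^term>\<open>c \<unlhd> d\<close> forces equal sizes, the candidates for the collapse of \<open>d\<close> are
  diagrams of the same size as \<open>d\<close>.
\<close>

definition is_collapse :: "(nat list \<Rightarrow> bool) \<Rightarrow> nat list \<Rightarrow> nat list \<Rightarrow> bool" where
  "is_collapse X d c \<longleftrightarrow> X c \<and> c \<unlhd> d \<and> (\<forall>c'. X c' \<and> c' \<unlhd> d \<longrightarrow> c' \<unlhd> c)"

definition C_collapse :: "nat list \<Rightarrow> nat list" where
  "C_collapse d = (THE c. is_collapse type_C d c)"

definition D_collapse :: "nat list \<Rightarrow> nat list" where
  "D_collapse d = (THE c. is_collapse type_D d c)"

definition Nil_sp :: "nat \<Rightarrow> nat list set" where
  "Nil_sp n = {d. type_C d \<and> sum_list d = 2 * n}"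

text \<open>Orbits of the full orthogonal group, so very even diagrams are not doubled.\<close>

definition Nil_o :: "nat \<Rightarrow> nat list set" where
  "Nil_o n = {d. type_D d \<and> sum_list d = 2 * n}"

definition Nil_o_special :: "nat \<Rightarrow> nat list set" where
  "Nil_o_special n = {d \<in> Nil_o n. type_C (yd_transpose d)}"

text \<open>
  The dual of the symplectic Lie algebra is identified with the algebra itself (half the trace
  form), so its nilpotent orbits are labelled by the same diagrams.
\<close>

definition Nil_sp_metaplectic_special :: "nat \<Rightarrow> nat list set" where
  "Nil_sp_metaplectic_special n = {d \<in> Nil_sp n. type_D (yd_transpose d)}"

definition d_LS :: "nat list \<Rightarrow> nat list" where
  "d_LS d = D_collapse (yd_transpose d)"

definition d_SP :: "nat list \<Rightarrow> nat list" where
  "d_SP d = C_collapse (remove_box_last (add_box_first d))"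

end

theory Submission
  imports Defs
begin

text \<open>
  A diagram is encoded by its partial sums \<open>S\<close>, a concave function with \<open>S 0 = 0\<close>; dominance is
  the pointwise order. Type C means that \<open>S k\<close> is odd only in the middle of a pair of equal odd
  rows, and type D means the same for \<open>S k + k\<close>. The collapse lowers this function by one
  wherever that condition fails; one such pass already gives a concave function.

  The transpose of \<open>d\<close> is of type C iff all \<open>S (2 i)\<close> are even, and of type D iff all
  \<open>S (2 i + 1)\<close> are even. The D-collapse does not change even values \<open>S (2 i)\<close>, so
  the values of \<open>d_LS\<close> are special. Transposition reverses dominance because it is the Legendre
  transform on partial sums, and collapses are monotone by their universal property. Finally,
  \<open>d_SP\<close> is inverted by the D-collapse.
\<close>

section \<open>Concave integer sequences and the lowering pass\<close>

text \<open>Supplies the parity of the right neighbour of a midpoint; this is why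
  \<open>pinned\<close> asks for evenness on the left alone.\<close>

lemma even_if_add_eq: "even a \<Longrightarrow> a + b = 2 * c \<Longrightarrow> even b" for a b c :: int
  by (metis even_add dvd_triv_left)

definition partial_sum :: "nat list \<Rightarrow> nat \<Rightarrow> int" where
  "partial_sum d k = int (sum_list (take k d))"

definition row :: "nat list \<Rightarrow> nat \<Rightarrow> nat" where
  "row d k = (if k < length d then d ! k else 0)"

definition concave :: "(nat \<Rightarrow> int) \<Rightarrow> bool" where
  "concave f \<longleftrightarrow> (\<forall>k. f k + f (Suc (Suc k)) \<le> 2 * f (Suc k))"

text \<open>
  The index \<open>k\<close> stands for position \<open>k + 1\<close>: an odd value there must lie halfway between two
  even neighbours.
\<close>

definition pinned :: "(nat \<Rightarrow> int) \<Rightarrow> nat \<Rightarrow> bool" where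
  "pinned f k \<longleftrightarrow> (odd (f (Suc k)) \<longrightarrow> even (f k) \<and> f k + f (Suc (Suc k)) = 2 * f (Suc k))"

text \<open>Every test is made on the original \<open>f\<close>, so all positions are lowered
  simultaneously. Position 0 stays fixed because partial sums start at 0.\<close>

definition lower :: "(nat \<Rightarrow> int) \<Rightarrow> nat \<Rightarrow> int" where
  "lower f k = (case k of 0 \<Rightarrow> f 0 | Suc j \<Rightarrow> if pinned f j then f k else f k - 1)"

lemma concaveD: "concave f \<Longrightarrow> f k + f (Suc (Suc k)) \<le> 2 * f (Suc k)"
  by (simp add: concave_def)

lemma lower_0 [simp]: "lower f 0 = f 0"
  by (simp add: lower_def)

lemma lower_Suc: "lower f (Suc j) = (if pinned f j then f (Suc j) else f (Suc j) - 1)"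
  by (simp add: lower_def)

lemma lower_le: "lower f k \<le> f k"
  by (cases k) (auto simp: lower_Suc)

lemma lower_even: "even (f k) \<Longrightarrow> lower f k = f k"
  by (cases k) (auto simp: lower_Suc pinned_def)

text \<open>At a kept position the neighbours can only drop. At a lowered one, both neighbours end
  up even, so their sum is an even number at most \<open>2 * f (Suc k)\<close>; equality would mean
  unchanged even neighbours around a midpoint, i.e. a pinned position. Hence the sum drops by at
  least 2.\<close>

lemma concave_lower:
  assumes "concave f" "even (f 0)"
  shows "concave (lower f)"
  unfolding concave_def
proof
  fix k
  have c: "f k + f (Suc (Suc k)) \<le> 2 * f (Suc k)"
    using assms(1) by (auto simp: concave_def)
  show "lower f k + lower f (Suc (Suc k)) \<le> 2 * lower f (Suc k)"
  proof (cases "pinned f k")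
    case True
    then show ?thesis
      using c lower_le[of f k] lower_le[of f "Suc (Suc k)"] by (simp add: lower_Suc)
  next
    case False
    then have odd: "odd (f (Suc k))" and
      ne: "even (f k) \<Longrightarrow> f k + f (Suc (Suc k)) \<noteq> 2 * f (Suc k)"
      by (auto simp: pinned_def)
    \<comment> \<open>A pinned odd left neighbour would be a midpoint between an even value and
      \<open>f (Suc k)\<close>, making the latter even.\<close>
    have l: "lower f k = f k - 1" if "odd (f k)"
    proof (cases k)
      case 0
      with that assms(2) show ?thesis by simp
    next
      case (Suc j)
      have "\<not> pinned f j"
      proof
        assume "pinned f j"
        with that Suc have "even (f j)" "f j + f (Suc k) = 2 * f k"
          by (simp_all add: pinned_def)
        then have "even (f (Suc k))" by (rule even_if_add_eq)
        with odd show False by simp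
      qed
      then show ?thesis using Suc by (simp add: lower_Suc)
    qed
    have r: "lower f (Suc (Suc k)) = f (Suc (Suc k)) - 1" if "odd (f (Suc (Suc k)))"
      using that odd by (auto simp: lower_Suc pinned_def)
    have "lower f (Suc k) = f (Suc k) - 1" using False by (simp add: lower_Suc)
    moreover have "lower f k + lower f (Suc (Suc k)) \<le> 2 * f (Suc k) - 2"
    proof -
      have "even (lower f k)" using l by (cases "even (f k)") (simp_all add: lower_even)
      moreover have "even (lower f (Suc (Suc k)))"
        using r by (cases "even (f (Suc (Suc k)))") (simp_all add: lower_even)
      ultimately have "even (lower f k + lower f (Suc (Suc k)))" by simp
      then obtain m where m: "lower f k + lower f (Suc (Suc k)) = 2 * m" by (rule evenE)
      note le = c lower_le[of f k] lower_le[of f "Suc (Suc k)"]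
      have "m \<noteq> f (Suc k)"
      proof
        assume "m = f (Suc k)"
        then have "lower f k = f k" and eq: "f k + f (Suc (Suc k)) = 2 * f (Suc k)"
          using m le by linarith+
        then have "even (f k)" using l by (cases "even (f k)") simp_all
        then show False using ne eq by simp
      qed
      moreover have "m \<le> f (Suc k)" using m le by linarith
      ultimately show ?thesis unfolding m by simp
    qed
    ultimately show ?thesis by simp
  qed
qed

text \<open>An odd value that survives was pinned, so its neighbours were even and are left alone
  too.\<close>

lemma pinned_lower: "pinned (lower f) k"
  unfolding pinned_def
proof
  assume o: "odd (lower f (Suc k))"
  then have p: "pinned f k" and o': "odd (f (Suc k))"
    by (auto simp: lower_Suc pinned_def split: if_splits)
  then have "even (f k)" "f k + f (Suc (Suc k)) = 2 * f (Suc k)"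
    by (auto simp: pinned_def)
  moreover from this have "even (f (Suc (Suc k)))" by (rule even_if_add_eq)
  ultimately show
    "even (lower f k) \<and> lower f k + lower f (Suc (Suc k)) = 2 * lower f (Suc k)"
    using p by (simp add: lower_even) (simp add: lower_Suc)
qed

text \<open>Only positions where \<open>g\<close> touches \<open>f\<close> matter, since elsewhere
  an integer gap of 1 is available. If \<open>g\<close> touches \<open>f\<close> at an odd value,
  \<open>g\<close> is affine there and lies below the concave \<open>f\<close>, so they agree at
  both neighbours and \<open>f\<close> is pinned as well.\<close>

lemma lower_greatest:
  assumes "concave f" "\<And>k. pinned g k" "\<And>k. g k \<le> f k"
  shows "g k \<le> lower f k"
proof (cases k)
  case 0
  then show ?thesis using assms(3) by simp
next
  case (Suc j)
  have "pinned f j" if "g (Suc j) = f (Suc j)"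
    unfolding pinned_def
  proof
    assume "odd (f (Suc j))"
    with that assms(2)[of j] have "even (g j)" "g j + g (Suc (Suc j)) = 2 * f (Suc j)"
      by (auto simp: pinned_def)
    moreover have "f j + f (Suc (Suc j)) \<le> 2 * f (Suc j)"
      using assms(1) by (auto simp: concave_def)
    moreover have "g j \<le> f j" "g (Suc (Suc j)) \<le> f (Suc (Suc j))"
      using assms(3) by auto
    ultimately have "g j = f j" "f j + f (Suc (Suc j)) = 2 * f (Suc j)" by linarith+
    with \<open>even (g j)\<close> show "even (f j) \<and> f j + f (Suc (Suc j)) = 2 * f (Suc j)" by simp
  qed
  moreover have "g (Suc j) \<le> f (Suc j)" by (fact assms(3))
  ultimately show ?thesis using Suc by (cases "g (Suc j) = f (Suc j)") (auto simp: lower_Suc)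
qed

section \<open>Young diagrams and their partial sums\<close>

lemma young_diagram_Cons:
  "young_diagram (x # xs) \<longleftrightarrow> x > 0 \<and> (\<forall>y\<in>set xs. y \<le> x) \<and> young_diagram xs"
  by (auto simp: young_diagram_def)

lemma partial_sum_0 [simp]: "partial_sum d 0 = 0"
  by (simp add: partial_sum_def)

lemma partial_sum_Nil [simp]: "partial_sum [] k = 0"
  by (simp add: partial_sum_def)

lemma partial_sum_Cons_Suc [simp]: "partial_sum (x # xs) (Suc k) = int x + partial_sum xs k"
  by (simp add: partial_sum_def)

lemma partial_sum_ge_length: "length d \<le> k \<Longrightarrow> partial_sum d k = int (sum_list d)"
  by (simp add: partial_sum_def)

lemma partial_sum_le: "partial_sum d k \<le> int (sum_list d)"
  unfolding partial_sum_def
  by (metis append_take_drop_id le_add1 of_nat_mono sum_list.append)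

lemma partial_sum_Suc: "partial_sum d (Suc k) = partial_sum d k + int (row d k)"
  by (simp add: partial_sum_def row_def take_Suc_conv_app_nth)

lemma row_antimono:
  assumes "young_diagram d" "i \<le> j"
  shows "row d j \<le> row d i"
  using assms
  by (cases "i = j") (auto simp: row_def young_diagram_def sorted_wrt_iff_nth_less)

lemma row_pos_iff: "young_diagram d \<Longrightarrow> 0 < row d k \<longleftrightarrow> k < length d"
  by (metis bot_nat_0.not_eq_extremum nth_mem row_def young_diagram_def)

lemma concave_partial_sum:
  assumes "young_diagram d"
  shows "concave (partial_sum d)"
  using row_antimono[OF assms, of k "Suc k" for k] by (simp add: concave_def partial_sum_Suc)

lemma young_diagram_eqI:
  assumes "young_diagram c" "young_diagram d" "\<And>k. row c k = row d k"
  shows "c = d"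
proof (rule nth_equalityI)
  show len: "length c = length d"
    using assms row_pos_iff by (metis linorder_neqE_nat nless_le)
  show "c ! i = d ! i" if "i < length c" for i
    using assms(3)[of i] that len by (simp add: row_def)
qed

lemma young_diagram_eqI_partial_sum:
  assumes "young_diagram c" "young_diagram d" "\<And>k. partial_sum c k = partial_sum d k"
  shows "c = d"
proof (rule young_diagram_eqI[OF assms(1,2)])
  show "row c k = row d k" for k
    using assms(3)[of k] assms(3)[of "Suc k"] by (simp add: partial_sum_Suc)
qed

lemma dominated_iff:
  "c \<unlhd> d \<longleftrightarrow> sum_list c = sum_list d \<and> (\<forall>k. partial_sum c k \<le> partial_sum d k)"
  by (simp add: dominated_def partial_sum_def)

lemma dominated_trans: "b \<unlhd> c \<Longrightarrow> c \<unlhd> d \<Longrightarrow> b \<unlhd> d"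
  unfolding dominated_def by (metis order_trans)

lemma dominated_antisym:
  "young_diagram c \<Longrightarrow> young_diagram d \<Longrightarrow> c \<unlhd> d \<Longrightarrow> d \<unlhd> c \<Longrightarrow> c = d"
  by (intro young_diagram_eqI_partial_sum order_antisym) (auto simp: dominated_iff)

text \<open>The differences of a concave function decrease; being eventually 0, they are nonnegative
  and serve as row lengths.\<close>

lemma ex_young_diagram:
  assumes conc: "concave g" and "g 0 = 0" and const: "\<And>k. M \<le> k \<Longrightarrow> g k = N"
  obtains d where "young_diagram d" "partial_sum d = g" "int (sum_list d) = N"
proof -
  define f where "f k = g (Suc k) - g k" for k
  have anti: "f j \<le> f i" if "i \<le> j" for i j
  proof (rule lift_Suc_antimono_le[OF _ that])
    show "f (Suc k) \<le> f k" for k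
      using conc[unfolded concave_def, rule_format, of k] by (simp add: f_def)
  qed
  have zero: "f k = 0" if "M \<le> k" for k
    using const that by (simp add: f_def)
  have nonneg: "f k \<ge> 0" for k
    using anti[of k "max k M"] zero[of "max k M"] by simp
  \<comment> \<open>Cutting at the first zero difference keeps all listed rows positive, and by
    monotonicity loses nothing.\<close>
  define L where "L = (LEAST m. f m = 0)"
  have L: "f L = 0" unfolding L_def by (rule LeastI[of _ M]) (simp add: zero)
  have pos: "f k > 0" if "k < L" for k
    using not_less_Least[of k "\<lambda>m. f m = 0"] that nonneg[of k] unfolding L_def by linarith
  have zero': "f k = 0" if "L \<le> k" for k
    using anti[OF that] L nonneg[of k] by simp
  define d where "d = map (\<lambda>k. nat (f k)) [0..<L]"
  have "sorted_wrt (\<ge>) d"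
    using anti by (auto simp: d_def sorted_wrt_iff_nth_less intro: nat_mono)
  moreover have "0 \<notin> set d" using pos by (fastforce simp: d_def)
  ultimately have yd: "young_diagram d" by (simp add: young_diagram_def)
  have row: "int (row d k) = f k" for k
    using nonneg[of k] zero'[of k] by (cases "k < L") (auto simp: row_def d_def)
  have ps: "partial_sum d k = g k" for k
    by (induction k) (simp_all add: assms(2) partial_sum_Suc row f_def)
  show ?thesis
  proof
    show "partial_sum d = g" using ps by blast
    show "int (sum_list d) = N"
      using ps[of "max M (length d)"] const[of "max M (length d)"]
      by (simp add: partial_sum_ge_length)
  qed (fact yd)
qed

section \<open>Types C and D as pinning conditions\<close>

text \<open>Deleting leading rows translates the index and changes the sums by a constant, which is
  harmless if even. This drives the induction on diagrams below.\<close>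

lemma pinned_shift:
  assumes "even c" "\<And>j. g (j + m) = f j + c"
  shows "pinned g (k + m) \<longleftrightarrow> pinned f k"
  using assms(1) assms(2)[of k] assms(2)[of "Suc k"] assms(2)[of "Suc (Suc k)"]
  by (simp add: pinned_def)

lemma all_nat_iff: "(\<forall>k. Q k) \<longleftrightarrow> Q 0 \<and> (\<forall>k. Q (Suc k))"
  by (metis nat.exhaust)

text \<open>The cases \<open>p = 0\<close> and \<open>p = 1\<close> are types C and D.\<close>

lemma even_count_iff_pinned:
  assumes "young_diagram d"
  shows "(\<forall>r. odd (int r + p) \<longrightarrow> even (count_list d r)) \<longleftrightarrow>
    (\<forall>k. pinned (\<lambda>k. partial_sum d k + p * int k) k)"
  using assms
proof (induction d rule: length_induct)
  case (1 d)
  show ?case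
  proof (cases d)
    case Nil
    then show ?thesis by (auto simp: pinned_def algebra_simps)
  next
    case (Cons x xs)
    then have x: "x > 0" "\<And>y. y \<in> set xs \<Longrightarrow> y \<le> x" and yxs: "young_diagram xs"
      using "1.prems" by (auto simp: young_diagram_Cons)
    define P where "P d k = pinned (\<lambda>k. partial_sum d k + p * int k) k" for d k
    show ?thesis
    proof (cases "even (int x + p)")
      \<comment> \<open>A row of unrestricted parity can be peeled off alone.\<close>
      case True
      have "(\<forall>r. odd (int r + p) \<longrightarrow> even (count_list d r)) \<longleftrightarrow>
        (\<forall>r. odd (int r + p) \<longrightarrow> even (count_list xs r))"
        using True Cons by auto
      also have "\<dots> \<longleftrightarrow> (\<forall>k. P xs k)"
        using 1 Cons yxs by (simp add: P_def)
      also have "\<dots> \<longleftrightarrow> (\<forall>k. P d (Suc k))"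
      proof -
        have "P d (k + 1) \<longleftrightarrow> P xs k" for k
          unfolding P_def
          by (rule pinned_shift[OF True]) (simp add: Cons algebra_simps)
        then show ?thesis by simp
      qed
      also have "\<dots> \<longleftrightarrow> (\<forall>k. P d k)"
      proof -
        have "P d 0" using True Cons by (simp add: P_def pinned_def)
        then show ?thesis by (simp add: all_nat_iff[of "P d"])
      qed
      finally show ?thesis by (simp add: P_def)
    next
      case False
      show ?thesis
      proof (cases "\<exists>ys. xs = x # ys")
        \<comment> \<open>Rows of restricted parity are peeled off in equal pairs, so the constant
          \<open>2 * (int x + p)\<close> is even; this needs induction on length.\<close>
        case True
        then obtain ys where ys: "d = x # x # ys" using Cons by auto
        have yys: "young_diagram ys" using yxs ys Cons by (auto simp: young_diagram_Cons)
        have "(\<forall>r. odd (int r + p) \<longrightarrow> even (count_list d r)) \<longleftrightarrow>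
          (\<forall>r. odd (int r + p) \<longrightarrow> even (count_list ys r))"
          using ys by auto
        also have "\<dots> \<longleftrightarrow> (\<forall>k. P ys k)"
          using 1 ys yys by (simp add: P_def)
        also have "\<dots> \<longleftrightarrow> (\<forall>k. P d (Suc (Suc k)))"
        proof -
          have "P d (k + 2) \<longleftrightarrow> P ys k" for k
            unfolding P_def
            by (rule pinned_shift[where c = "2 * (int x + p)"]) (simp_all add: ys algebra_simps)
          then show ?thesis by simp
        qed
        also have "\<dots> \<longleftrightarrow> (\<forall>k. P d k)"
        proof -
          have "P d 0" "P d (Suc 0)"
            using False ys by (auto simp: P_def pinned_def algebra_simps)
          then show ?thesis
            by (simp add: all_nat_iff[of "P d"] all_nat_iff[of "\<lambda>k. P d (Suc k)"])
        qed
        finally show ?thesis by (simp add: P_def)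
      next
        case ne: False
        have "x \<notin> set xs"
        proof
          assume "x \<in> set xs"
          then obtain z zs where z: "xs = z # zs" by (cases xs) auto
          with x yxs \<open>x \<in> set xs\<close> have "z = x"
            by (auto simp: young_diagram_Cons intro: order_antisym)
          with z ne show False by simp
        qed
        then have "count_list d x = 1" using Cons by (simp add: count_notin)
        \<comment> \<open>Pinning at the first position would force the second row to equal
          \<open>x\<close>, but \<open>x\<close> occurs only once.\<close>
        moreover have "\<not> P d 0"
        proof
          assume "P d 0"
          then have "partial_sum xs (Suc 0) = int x"
            using False Cons by (simp add: P_def pinned_def)
          then show False using ne x(1) by (cases xs) auto
        qed
        ultimately have "\<not> (\<forall>r. odd (int r + p) \<longrightarrow> even (count_list d r))" "\<not> (\<forall>k. P d k)"
          using False odd_one by metis+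
        then show ?thesis unfolding P_def by blast
      qed
    qed
  qed
qed

text \<open>The factor \<open>0 * int k\<close> is kept so that the statement matches the hypothesis
  of \<open>ex_collapse\<close> at \<open>p = 0\<close>.\<close>

lemma type_C_iff:
  "type_C d \<longleftrightarrow> young_diagram d \<and> even (sum_list d) \<and>
     (\<forall>k. pinned (\<lambda>k. partial_sum d k + 0 * int k) k)"
  using even_count_iff_pinned[of d 0] by (auto simp: type_C_def)

lemma type_D_iff:
  "type_D d \<longleftrightarrow> young_diagram d \<and> even (sum_list d) \<and>
     (\<forall>k. pinned (\<lambda>k. partial_sum d k + 1 * int k) k)"
  using even_count_iff_pinned[of d 1] by (auto simp: type_D_def)

lemma pinned_type_D: "type_D d \<Longrightarrow> pinned (\<lambda>k. partial_sum d k + int k) k"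
  by (simp add: type_D_iff)

lemma pinned_type_C: "type_C d \<Longrightarrow> pinned (partial_sum d) k"
  by (simp add: type_C_iff)

lemma type_C_imp_young_diagram: "type_C d \<Longrightarrow> young_diagram d"
  by (simp add: type_C_def)

lemma type_D_imp_young_diagram: "type_D d \<Longrightarrow> young_diagram d"
  by (simp add: type_D_def)

section \<open>Existence and partial sums of collapses\<close>

lemma collapse_unique:
  assumes "\<And>d. X d \<Longrightarrow> young_diagram d" "is_collapse X d b" "is_collapse X d c"
  shows "b = c"
  using assms by (intro dominated_antisym) (simp_all add: is_collapse_def)

lemma collapse_mono:
  "is_collapse X c c' \<Longrightarrow> is_collapse X d d' \<Longrightarrow> c \<unlhd> d \<Longrightarrow> c' \<unlhd> d'"
  using dominated_trans[of c' c d] by (simp add: is_collapse_def)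

text \<open>Adding the linear term \<open>p * int k\<close> preserves concavity and pointwise
  comparison, so a single lowering pass treats both types, and its maximality is
  \<open>lower_greatest\<close>.\<close>

lemma ex_collapse:
  assumes X: "\<And>d. X d \<longleftrightarrow> young_diagram d \<and> even (sum_list d) \<and>
      (\<forall>k. pinned (\<lambda>k. partial_sum d k + p * int k) k)"
    and yd: "young_diagram d" and ev: "even (sum_list d)"
  obtains c where "is_collapse X d c"
    "\<And>k. partial_sum c k = lower (\<lambda>k. partial_sum d k + p * int k) k - p * int k"
proof -
  define f where "f k = partial_sum d k + p * int k" for k
  define g where "g k = lower f k - p * int k" for k
  have conc: "concave f"
    using concave_partial_sum[OF yd] by (auto simp: f_def concave_def algebra_simps)
  have f0: "f 0 = 0" by (simp add: f_def)
  have "concave (lower f)" using conc f0 by (simp add: concave_lower)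
  then have "concave g" by (auto simp: g_def concave_def algebra_simps)
  moreover have "g 0 = 0" by (simp add: g_def f0)
  \<comment> \<open>The bound is \<open>Suc (length d)\<close> because pinning at \<open>k\<close>
    also inspects \<open>k - 1\<close>. From \<open>length d\<close> on, \<open>f\<close> is affine
    with even constant term, hence pinned.\<close>
  moreover have "g k = int (sum_list d)" if "Suc (length d) \<le> k" for k
  proof -
    obtain j where k: "k = Suc j" using \<open>Suc (length d) \<le> k\<close> by (cases k) auto
    have fk: "f i = int (sum_list d) + p * int i" if "j \<le> i" for i
      using that \<open>Suc (length d) \<le> k\<close> k by (simp add: f_def partial_sum_ge_length)
    have "pinned f j"
      using ev by (auto simp: pinned_def fk algebra_simps)
    then show ?thesis by (simp add: g_def k lower_Suc fk)
  qed
  ultimately obtain c where c: "young_diagram c" "partial_sum c = g"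
      "int (sum_list c) = int (sum_list d)"
    using ex_young_diagram by blast
  have fg: "lower f = (\<lambda>k. partial_sum c k + p * int k)"
    by (auto simp: c(2) g_def)
  have "\<forall>k. pinned (\<lambda>k. partial_sum c k + p * int k) k"
    using pinned_lower[of f] unfolding fg by blast
  then have "X c" using c(1,3) ev by (simp add: X)
  moreover have "c \<unlhd> d"
    using c(3) lower_le[of f] by (simp add: dominated_iff c(2) g_def f_def algebra_simps)
  moreover have "b \<unlhd> c" if "X b" "b \<unlhd> d" for b
  proof -
    have "partial_sum b k + p * int k \<le> lower f k" for k
      by (rule lower_greatest[OF conc]) (use that in \<open>auto simp: X dominated_iff f_def\<close>)
    then have "partial_sum b k \<le> partial_sum c k" for k
      by (simp add: c(2) g_def algebra_simps)
    then show ?thesis using that c(3) by (simp add: dominated_iff)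
  qed
  ultimately have "is_collapse X d c" by (auto simp: is_collapse_def)
  moreover have "partial_sum c k = lower (\<lambda>k. partial_sum d k + p * int k) k - p * int k" for k
    by (simp add: c(2) g_def f_def[abs_def])
  ultimately show ?thesis using that by blast
qed

lemma C_collapse:
  assumes "young_diagram d" "even (sum_list d)"
  shows "is_collapse type_C d (C_collapse d)"
    and "partial_sum (C_collapse d) k = lower (partial_sum d) k"
proof -
  obtain c where c: "is_collapse type_C d c"
    and ps: "\<And>k. partial_sum c k = lower (partial_sum d) k"
    using ex_collapse[OF type_C_iff assms] by auto
  have "C_collapse d = c"
    unfolding C_collapse_def
    using c collapse_unique[of type_C, OF type_C_imp_young_diagram] by (intro the_equality)
  then show "is_collapse type_C d (C_collapse d)"
    and "partial_sum (C_collapse d) k = lower (partial_sum d) k"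
    using c ps by auto
qed

lemma D_collapse:
  assumes "young_diagram d" "even (sum_list d)"
  shows "is_collapse type_D d (D_collapse d)"
    and "partial_sum (D_collapse d) k = lower (\<lambda>k. partial_sum d k + int k) k - int k"
proof -
  obtain c where c: "is_collapse type_D d c"
    and ps: "\<And>k. partial_sum c k = lower (\<lambda>k. partial_sum d k + int k) k - int k"
    using ex_collapse[OF type_D_iff assms] by auto
  have "D_collapse d = c"
    unfolding D_collapse_def
    using c collapse_unique[of type_D, OF type_D_imp_young_diagram] by (intro the_equality)
  then show "is_collapse type_D d (D_collapse d)"
    and "partial_sum (D_collapse d) k = lower (\<lambda>k. partial_sum d k + int k) k - int k"
    using c ps by auto
qed

lemma D_collapse_type_D: "type_D d \<Longrightarrow> D_collapse d = d"
  unfolding D_collapse_def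
  using collapse_unique[of type_D, OF type_D_imp_young_diagram, of d d]
  by (intro the_equality) (auto simp: is_collapse_def dominated_def)

section \<open>Transposition and dominance\<close>

text \<open>As the rows decrease, those longer than \<open>j\<close> form an initial
  segment.\<close>

lemma less_length_filter_iff:
  assumes "young_diagram d"
  shows "i < length (filter (\<lambda>x. j < x) d) \<longleftrightarrow> j < row d i"
  using assms
proof (induction d arbitrary: i)
  case Nil
  then show ?case by (simp add: row_def)
next
  case (Cons x xs)
  show ?case
  proof (cases "j < x")
    case True
    then show ?thesis using Cons by (cases i) (auto simp: row_def young_diagram_Cons)
  next
    case False
    then have "filter (\<lambda>x. j < x) xs = []" and "row (x # xs) i \<le> x"
      using Cons.prems row_antimono[OF Cons.prems, of 0 i]
      by (auto simp: filter_empty_conv young_diagram_Cons row_def)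
    then show ?thesis using False by auto
  qed
qed

lemma row_transpose:
  assumes "young_diagram d"
  shows "row (yd_transpose d) j = length (filter (\<lambda>x. j < x) d)"
  using assms
  by (cases d) (auto simp: yd_transpose_def row_def young_diagram_Cons filter_empty_conv not_less)

text \<open>Both sides say that the box in row \<open>i\<close> and column \<open>j\<close> belongs
  to \<open>d\<close>. Monotonicity of the columns and involutivity are read off this
  symmetry.\<close>

lemma less_row_transpose_iff:
  "young_diagram d \<Longrightarrow> i < row (yd_transpose d) j \<longleftrightarrow> j < row d i"
  by (simp add: row_transpose less_length_filter_iff)

lemma length_transpose: "length (yd_transpose d) = row d 0"
  by (simp add: yd_transpose_def row_def split: list.split)

lemma young_diagram_transpose:
  assumes "young_diagram d"
  shows "young_diagram (yd_transpose d)"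
proof -
  have nth: "yd_transpose d ! i = row (yd_transpose d) i" if "i < row d 0" for i
    using that by (simp add: row_def[of "yd_transpose d"] length_transpose)
  have "0 < row (yd_transpose d) i" if "i < row d 0" for i
    using that assms by (simp add: less_row_transpose_iff)
  moreover have "row (yd_transpose d) j \<le> row (yd_transpose d) i" if "i < j" for i j
  proof (rule ccontr)
    assume "\<not> ?thesis"
    then have "j < row d (row (yd_transpose d) i)"
      using assms by (simp add: less_row_transpose_iff[symmetric])
    then show False
      using that less_row_transpose_iff[OF assms, of "row (yd_transpose d) i" i] by simp
  qed
  ultimately show ?thesis
    by (force simp: young_diagram_def sorted_wrt_iff_nth_less in_set_conv_nth length_transpose nth)
qed

lemma transpose_transpose:
  assumes "young_diagram d"
  shows "yd_transpose (yd_transpose d) = d"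
proof (rule young_diagram_eqI)
  fix k
  have "i < row (yd_transpose (yd_transpose d)) k \<longleftrightarrow> i < row d k" for i
    using assms by (simp add: less_row_transpose_iff young_diagram_transpose)
  then show "row (yd_transpose (yd_transpose d)) k = row d k"
    by (meson linorder_neqE_nat less_irrefl)
qed (use assms in \<open>auto intro: young_diagram_transpose\<close>)

lemma sum_list_min_Suc:
  "(\<Sum>x\<leftarrow>d. min x (Suc j)) = (\<Sum>x\<leftarrow>d. min x j) + length (filter (\<lambda>x. j < x) d)"
  by (induction d) auto

text \<open>The boxes in the first \<open>j\<close> columns, counted by columns and by rows.\<close>

lemma partial_sum_transpose:
  assumes "young_diagram d"
  shows "partial_sum (yd_transpose d) j = int (\<Sum>x\<leftarrow>d. min x j)"
proof (induction j)
  case 0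
  then show ?case by simp
next
  case (Suc j)
  then show ?case using assms
    by (simp only: partial_sum_Suc sum_list_min_Suc row_transpose of_nat_add)
qed

lemma sum_list_transpose:
  assumes "young_diagram d"
  shows "sum_list (yd_transpose d) = sum_list d"
proof -
  have "map (\<lambda>x. min x (row d 0)) d = map (\<lambda>x. x) d"
    using assms by (cases d) (auto simp: row_def young_diagram_Cons intro!: map_idI)
  then show ?thesis
    using partial_sum_transpose[OF assms, of "row d 0"]
    by (simp add: partial_sum_ge_length length_transpose)
qed

text \<open>
  With partial_sum_transpose, this is one half of the statement that transposition is the Legendre
  transform on partial sums; sum_list_min_eq is the other half.
\<close>

lemma sum_list_min_le:
  "int (\<Sum>x\<leftarrow>d. min x j) \<le> int (sum_list d) - partial_sum d k + int j * int k"
proof (induction d arbitrary: k)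
  case Nil
  then show ?case by simp
next
  case (Cons x xs)
  show ?case
  proof (cases k)
    case 0
    then show ?thesis using Cons[of 0] by simp
  next
    case (Suc i)
    then show ?thesis using Cons[of i] by (simp add: algebra_simps)
  qed
qed

text \<open>The witness is the number of rows longer than \<open>j\<close>: each of these
  contributes \<open>j\<close>, and the others contribute their full length.\<close>

lemma sum_list_min_eq:
  assumes "young_diagram d"
  shows "\<exists>k. int (\<Sum>x\<leftarrow>d. min x j) = int (sum_list d) - partial_sum d k + int j * int k"
  using assms
proof (induction d)
  case Nil
  then show ?case by (auto intro: exI[of _ 0])
next
  case (Cons x xs)
  then obtain k where k:
    "int (\<Sum>x\<leftarrow>xs. min x j) = int (sum_list xs) - partial_sum xs k + int j * int k"
    by (auto simp: young_diagram_Cons)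
  show ?case
  proof (cases "j < x")
    case True
    then show ?thesis using k by (intro exI[of _ "Suc k"]) (simp add: algebra_simps)
  next
    case False
    then have "map (\<lambda>x. min x j) (x # xs) = map (\<lambda>x. x) (x # xs)"
      using Cons.prems by (auto simp: young_diagram_Cons intro!: map_idI)
    then show ?thesis by (intro exI[of _ 0]) simp
  qed
qed

lemma transpose_antimono:
  assumes "young_diagram c" "young_diagram d" "c \<unlhd> d"
  shows "yd_transpose d \<unlhd> yd_transpose c"
proof -
  have "partial_sum (yd_transpose d) j \<le> partial_sum (yd_transpose c) j" for j
  proof -
    \<comment> \<open>A minimiser for \<open>c\<close> is also a candidate for \<open>d\<close>,
      where the value is no larger because \<open>d\<close> has the larger partial sum.\<close>
    obtain k where
      "int (\<Sum>x\<leftarrow>c. min x j) = int (sum_list c) - partial_sum c k + int j * int k"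
      using sum_list_min_eq[OF assms(1)] by blast
    moreover have "partial_sum c k \<le> partial_sum d k" "sum_list c = sum_list d"
      using assms(3) by (auto simp: dominated_iff)
    ultimately show ?thesis
      using sum_list_min_le[of j d k] assms by (simp add: partial_sum_transpose)
  qed
  then show ?thesis using assms by (simp add: dominated_iff sum_list_transpose)
qed

section \<open>Parity criteria for the type of a transpose\<close>

text \<open>A column has height \<open>Suc k\<close> exactly when it meets row \<open>k\<close> but
  not row \<open>Suc k\<close>.\<close>

lemma count_list_transpose:
  assumes "young_diagram d"
  shows "count_list (yd_transpose d) (Suc k) = row d k - row d (Suc k)"
proof -
  have "count_list (yd_transpose d) (Suc k) =
    card {j. j < row d 0 \<and> row (yd_transpose d) j = Suc k}"
    by (auto simp: count_list_eq_length_filter length_filter_conv_card length_transpose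
        row_def[of "yd_transpose d"] intro!: arg_cong[where f = card])
  also have "{j. j < row d 0 \<and> row (yd_transpose d) j = Suc k} = {row d (Suc k)..<row d k}"
  proof -
    have "row (yd_transpose d) j = Suc k \<longleftrightarrow> \<not> j < row d (Suc k) \<and> j < row d k" for j
      using less_row_transpose_iff[OF assms, of k j] less_row_transpose_iff[OF assms, of "Suc k" j]
      by linarith
    moreover have "row d k \<le> row d 0" using row_antimono[OF assms] by simp
    ultimately show ?thesis by (simp only: set_eq_iff mem_Collect_eq atLeastLessThan_iff) linarith
  qed
  finally show ?thesis by simp
qed

text \<open>The multiplicity of \<open>2 * i + 1\<close> is a difference of two consecutive rows,
  congruent mod 2 to their sum. These sums telescope from
  \<open>partial_sum d 0 = 0\<close>.\<close>

lemma type_C_transpose_iff: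
  assumes "young_diagram d" "even (sum_list d)"
  shows "type_C (yd_transpose d) \<longleftrightarrow> (\<forall>i. even (partial_sum d (2 * i)))"
proof -
  have "type_C (yd_transpose d) \<longleftrightarrow>
    (\<forall>r. odd r \<longrightarrow> even (count_list (yd_transpose d) r))"
    using assms by (simp add: type_C_def young_diagram_transpose sum_list_transpose)
  also have "\<dots> \<longleftrightarrow> (\<forall>i. even (row d (2 * i) - row d (Suc (2 * i))))"
  proof -
    have "(\<forall>r. odd r \<longrightarrow> Q r) \<longleftrightarrow> (\<forall>i. Q (Suc (2 * i)))" for Q
      by (auto elim: oddE)
    then show ?thesis using assms(1) by (simp add: count_list_transpose)
  qed
  also have "\<dots> \<longleftrightarrow> (\<forall>i. even (partial_sum d (Suc (Suc (2 * i))) - partial_sum d (2 * i)))"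
  proof -
    have "even (row d (2 * i) - row d (Suc (2 * i))) \<longleftrightarrow>
        even (partial_sum d (Suc (Suc (2 * i))) - partial_sum d (2 * i))" for i
      using row_antimono[OF assms(1), of "2 * i" "Suc (2 * i)"]
      by (simp add: partial_sum_Suc even_diff_nat)
    then show ?thesis by simp
  qed
  also have "\<dots> \<longleftrightarrow> (\<forall>i. even (partial_sum d (2 * i)))"
  proof
    assume *: "\<forall>i. even (partial_sum d (Suc (Suc (2 * i))) - partial_sum d (2 * i))"
    show "\<forall>i. even (partial_sum d (2 * i))"
    proof
      show "even (partial_sum d (2 * i))" for i
        by (induction i) (use * in auto)
    qed
  next
    assume *: "\<forall>i. even (partial_sum d (2 * i))"
    show "\<forall>i. even (partial_sum d (Suc (Suc (2 * i))) - partial_sum d (2 * i))"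
      using * *[rule_format, of "Suc i" for i] by simp
  qed
  finally show ?thesis .
qed

text \<open>Here the telescoping runs over odd positions, with no known value at its start. It is
  anchored at the far end, beyond all rows, where the partial sum is the even size.\<close>

lemma type_D_transpose_iff:
  assumes "young_diagram d" "even (sum_list d)"
  shows "type_D (yd_transpose d) \<longleftrightarrow> (\<forall>i. even (partial_sum d (Suc (2 * i))))"
proof -
  have pos: "0 \<notin> set (yd_transpose d)"
    using young_diagram_transpose[OF assms(1)] by (simp add: young_diagram_def)
  have "type_D (yd_transpose d) \<longleftrightarrow>
    (\<forall>r. even r \<longrightarrow> even (count_list (yd_transpose d) r))"
    using assms by (simp add: type_D_def young_diagram_transpose sum_list_transpose)
  also have "\<dots> \<longleftrightarrow> (\<forall>i. even (count_list (yd_transpose d) (Suc (Suc (2 * i)))))"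
  proof
    assume *: "\<forall>i. even (count_list (yd_transpose d) (Suc (Suc (2 * i))))"
    show "\<forall>r. even r \<longrightarrow> even (count_list (yd_transpose d) r)"
    proof (intro allI impI)
      fix r :: nat
      assume "even r"
      then obtain i where "r = 2 * i" by blast
      then show "even (count_list (yd_transpose d) r)"
        using * pos by (cases i) (auto simp: count_notin)
    qed
  qed auto
  also have "\<dots> \<longleftrightarrow> (\<forall>i. even (row d (Suc (2 * i)) - row d (Suc (Suc (2 * i)))))"
    using assms(1) by (simp add: count_list_transpose)
  also have "\<dots> \<longleftrightarrow>
    (\<forall>i. even (partial_sum d (Suc (Suc (Suc (2 * i)))) - partial_sum d (Suc (2 * i))))"
  proof -
    have "even (row d (Suc (2 * i)) - row d (Suc (Suc (2 * i)))) \<longleftrightarrow>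
        even (partial_sum d (Suc (Suc (Suc (2 * i)))) - partial_sum d (Suc (2 * i)))" for i
      using row_antimono[OF assms(1), of "Suc (2 * i)" "Suc (Suc (2 * i))"]
      by (simp add: partial_sum_Suc even_diff_nat)
    then show ?thesis by simp
  qed
  also have "\<dots> \<longleftrightarrow> (\<forall>i. even (partial_sum d (Suc (2 * i))))"
  proof
    assume *: "\<forall>i. even (partial_sum d (Suc (Suc (Suc (2 * i)))) - partial_sum d (Suc (2 * i)))"
    show "\<forall>i. even (partial_sum d (Suc (2 * i)))"
    proof
      fix i
      have "even (partial_sum d (Suc (2 * (i + j))) - partial_sum d (Suc (2 * i)))" for j
      proof (induction j)
        case (Suc j)
        then show ?case using *[rule_format, of "i + j"] by simp
      qed simp
      then have "even (partial_sum d (Suc (2 * (i + length d))) - partial_sum d (Suc (2 * i)))" .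
      then show "even (partial_sum d (Suc (2 * i)))"
        using assms(2) by (simp add: partial_sum_ge_length)
    qed
  next
    assume *: "\<forall>i. even (partial_sum d (Suc (2 * i)))"
    show "\<forall>i. even (partial_sum d (Suc (Suc (Suc (2 * i)))) - partial_sum d (Suc (2 * i)))"
      using * *[rule_format, of "Suc i" for i] by simp
  qed
  finally show ?thesis .
qed

section \<open>Moving a box from the last row to the first\<close>

lemma remove_box_last_props:
  assumes "young_diagram d" "d \<noteq> []"
  shows "young_diagram (remove_box_last d)"
    and "partial_sum (remove_box_last d) k = min (partial_sum d k) (int (sum_list d) - 1)"
    and "int (sum_list (remove_box_last d)) = int (sum_list d) - 1"
proof -
  obtain ys x where d: "d = ys @ [x]" using assms(2) by (cases d rule: rev_cases) auto
  have x: "x > 0" "sorted_wrt (\<ge>) ys" "0 \<notin> set ys" "\<And>y. y \<in> set ys \<Longrightarrow> x \<le> y"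
    using assms(1) by (auto simp: d young_diagram_def sorted_wrt_append)
  show "young_diagram (remove_box_last d)"
    using x by (fastforce simp: d remove_box_last_def young_diagram_def sorted_wrt_append)
  \<comment> \<open>A final zero row does not affect sums, so both branches of
    \<open>remove_box_last\<close> can be treated as \<open>ys @ [x - 1]\<close>.\<close>
  have r: "sum_list (take k (remove_box_last d)) = sum_list (take k (ys @ [x - 1]))" for k
    using x(1) by (cases "k - length ys") (auto simp: d remove_box_last_def)
  show "partial_sum (remove_box_last d) k = min (partial_sum d k) (int (sum_list d) - 1)"
  proof (cases "k \<le> length ys")
    case True
    then show ?thesis
      using x(1) partial_sum_le[of ys k] by (simp add: partial_sum_def r[unfolded d] d)
  next
    case False
    then show ?thesis using x(1) by (simp add: partial_sum_def r[unfolded d] d)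
  qed
  show "int (sum_list (remove_box_last d)) = int (sum_list d) - 1"
    using x(1) by (simp add: d remove_box_last_def)
qed

text \<open>
  The effect of \<open>d \<mapsto> (d\<^sup>+)\<^sup>-\<close> on the partial sums of a diagram of size \<open>N\<close>.
\<close>

definition shift_box :: "int \<Rightarrow> (nat \<Rightarrow> int) \<Rightarrow> nat \<Rightarrow> int" where
  "shift_box N f k = (if k = 0 then 0 else min N (f k + 1))"

lemma remove_box_last_add_box_first:
  assumes "young_diagram d"
  shows "young_diagram (remove_box_last (add_box_first d))"
    and "partial_sum (remove_box_last (add_box_first d)) = shift_box (int (sum_list d)) (partial_sum d)"
    and "sum_list (remove_box_last (add_box_first d)) = sum_list d"
proof -
  let ?e = "add_box_first d"
  have e: "young_diagram ?e" "?e \<noteq> []" "sum_list ?e = Suc (sum_list d)"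
    using assms by (auto simp: add_box_first_def young_diagram_def intro: le_SucI split: list.split)
  have ps: "partial_sum ?e k = (if k = 0 then 0 else partial_sum d k + 1)" for k
    by (cases k) (auto simp: add_box_first_def split: list.split)
  show "young_diagram (remove_box_last ?e)"
    using remove_box_last_props e by blast
  show "partial_sum (remove_box_last ?e) = shift_box (int (sum_list d)) (partial_sum d)"
    using e by (auto simp: fun_eq_iff remove_box_last_props ps shift_box_def)
  show "sum_list (remove_box_last ?e) = sum_list d"
    using remove_box_last_props(3)[of ?e] e by simp
qed

section \<open>Mutually inverse lowering passes\<close>

lemma nat_parity_cases:
  obtains "k = 0" | i where "k = Suc (2 * i)" | i where "k = Suc (Suc (2 * i))"
proof (cases "even k")
  case True
  then obtain j where "k = 2 * j" by blast
  then show ?thesis using that(1) that(3)[of "j - 1"] by (cases j) auto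
next
  case False
  then show ?thesis using that(2) by (auto elim: oddE)
qed

text \<open>For special \<open>f\<close>, the C-collapse after moving the box rounds odd positions
  up to even values, which gives metaplectic specialness. At even positions the bound within 1 is
  enough for the inverse.\<close>

lemma special_lower_shift_box:
  assumes f0: "f 0 = 0" and f_le: "\<And>k. f k \<le> N" and N: "even N"
    and ev: "\<And>i. even (f (2 * i))"
    and pin: "\<And>k. pinned (\<lambda>k. f k + int k) k"
  shows "lower (shift_box N f) (Suc (2 * i)) =
      (if odd (f (Suc (2 * i))) then f (Suc (2 * i)) + 1 else f (Suc (2 * i)))" (is ?odd)
    and "lower (shift_box N f) (2 * i) \<in> {f (2 * i), f (2 * i) + 1}" (is ?even)
proof -
  let ?g = "shift_box N f"
  have ev': "even (f (Suc (Suc (2 * i))))" using ev[of "Suc i"] by simp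
  show ?odd
  proof (cases "odd (f (Suc (2 * i)))")
    case True
    then have "f (Suc (2 * i)) < N" using f_le[of "Suc (2 * i)"] N by (metis order_le_less)
    then have "?g (Suc (2 * i)) = f (Suc (2 * i)) + 1" by (simp add: shift_box_def)
    then show ?thesis using True by (simp add: lower_even)
  next
    case False
    \<comment> \<open>The position is odd and \<open>f\<close> is even there, so the type D
      condition makes it a midpoint. If \<open>?g\<close> were pinned there, it would exceed
      \<open>f\<close> by 1 at both neighbours, and so be odd at \<open>2 * i\<close>.\<close>
    have eq: "f (2 * i) + f (Suc (Suc (2 * i))) = 2 * f (Suc (2 * i))"
      using pin[of "2 * i"] False by (simp add: pinned_def)
    show ?thesis
    proof (cases "f (Suc (2 * i)) = N")
      case True
      then have "?g (Suc (2 * i)) = N" by (simp add: shift_box_def)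
      then show ?thesis using True N by (simp add: lower_even)
    next
      case ne: False
      then have g: "?g (Suc (2 * i)) = f (Suc (2 * i)) + 1"
        using f_le[of "Suc (2 * i)"] by (simp add: shift_box_def)
      have "\<not> pinned ?g (2 * i)"
      proof
        assume "pinned ?g (2 * i)"
        then have "even (?g (2 * i))" "?g (2 * i) + ?g (Suc (Suc (2 * i))) = 2 * f (Suc (2 * i)) + 2"
          using g False by (auto simp: pinned_def)
        moreover have "?g (2 * i) \<le> f (2 * i) + 1" "?g (Suc (Suc (2 * i))) \<le> f (Suc (Suc (2 * i))) + 1"
          using f0 by (auto simp: shift_box_def)
        ultimately have "?g (2 * i) = f (2 * i) + 1" using eq by linarith
        then show False using ev[of i] \<open>even (?g (2 * i))\<close> by simp
      qed
      then show ?thesis using g False by (simp add: lower_Suc)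
    qed
  qed
  show ?even
  proof (cases "2 * i = 0 \<or> f (2 * i) = N")
    case True
    then have "?g (2 * i) = f (2 * i)" using f0 by (auto simp: shift_box_def)
    then show ?thesis using ev[of i] by (simp add: lower_even)
  next
    case False
    then have g: "?g (2 * i) = f (2 * i) + 1"
      using f_le[of "2 * i"] by (simp add: shift_box_def)
    show ?thesis using g False by (auto simp: lower_def split: nat.split)
  qed
qed

text \<open>The D-collapse undoes \<open>d_SP\<close>. At odd positions, a value raised by 1 cannot
  be pinned without violating concavity of \<open>f\<close>, while an unraised one is a midpoint and
  stays. At even positions, a raised value has a left neighbour of the wrong parity, so it is
  lowered.\<close>

lemma lower_lower_shift_box:
  assumes f0: "f 0 = 0" and conc: "concave f" and f_le: "\<And>k. f k \<le> N" and N: "even N"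
    and ev: "\<And>i. even (f (2 * i))"
    and pin: "\<And>k. pinned (\<lambda>k. f k + int k) k"
    and conc_h: "concave (lower (shift_box N f))"
  shows "lower (\<lambda>k. lower (shift_box N f) k + int k) k - int k = f k"
proof -
  define h where "h = lower (shift_box N f)"
  define u where "u k = h k + int k" for k
  have h_odd: "h (Suc (2 * i)) =
      (if odd (f (Suc (2 * i))) then f (Suc (2 * i)) + 1 else f (Suc (2 * i)))" for i
    using special_lower_shift_box[OF f0 f_le N ev pin] by (simp add: h_def)
  have h_even: "h (2 * i) \<in> {f (2 * i), f (2 * i) + 1}" for i
    using special_lower_shift_box[OF f0 f_le N ev pin] by (simp add: h_def)
  have "lower u k - int k = f k"
  proof (cases k rule: nat_parity_cases)
    case 1
    then show ?thesis by (simp add: u_def h_def f0 shift_box_def)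
  next
    case (2 i)
    have c: "h (2 * i) + h (Suc (Suc (2 * i))) \<le> 2 * h (Suc (2 * i))"
      using conc_h by (simp add: h_def concave_def)
    have b: "h (2 * i) \<in> {f (2 * i), f (2 * i) + 1}"
      "h (Suc (Suc (2 * i))) \<in> {f (Suc (Suc (2 * i))), f (Suc (Suc (2 * i))) + 1}"
      using h_even[of i] h_even[of "Suc i"] by simp_all
    have e: "even (f (2 * i))" "even (f (Suc (Suc (2 * i))))"
      using ev[of i] ev[of "Suc i"] by simp_all
    show ?thesis
    proof (cases "odd (f (Suc (2 * i)))")
      case True
      then have ho: "h (Suc (2 * i)) = f (Suc (2 * i)) + 1" by (simp add: h_odd)
      have "\<not> pinned u (2 * i)"
      proof
        assume "pinned u (2 * i)"
        then have "even (h (2 * i))" "h (2 * i) + h (Suc (Suc (2 * i))) = 2 * h (Suc (2 * i))"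
          using True ho by (auto simp: pinned_def u_def)
        moreover from this have "even (h (Suc (Suc (2 * i))))" by (rule even_if_add_eq)
        ultimately have "h (2 * i) = f (2 * i)" "h (Suc (Suc (2 * i))) = f (Suc (Suc (2 * i)))"
          using b e by auto
        then show False
          using \<open>h (2 * i) + h (Suc (Suc (2 * i))) = 2 * h (Suc (2 * i))\<close> ho concaveD[OF conc, of "2 * i"]
          by simp
      qed
      then show ?thesis by (simp add: 2 lower_Suc u_def ho)
    next
      case False
      then have ho: "h (Suc (2 * i)) = f (Suc (2 * i))" by (simp add: h_odd)
      have "f (2 * i) + f (Suc (Suc (2 * i))) = 2 * f (Suc (2 * i))"
        using pin[of "2 * i"] False by (simp add: pinned_def)
      \<comment> \<open>Concavity of \<open>h\<close> leaves no room for raising either neighbour of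
        a midpoint.\<close>
      with b c ho have "h (2 * i) = f (2 * i)" "h (Suc (Suc (2 * i))) = f (Suc (Suc (2 * i)))"
        by auto
      then have "pinned u (2 * i)"
        using e(1) ho \<open>f (2 * i) + f (Suc (Suc (2 * i))) = 2 * f (Suc (2 * i))\<close>
        by (simp add: pinned_def u_def)
      then show ?thesis by (simp add: 2 lower_Suc u_def ho)
    qed
  next
    case (3 i)
    have ho: "even (h (Suc (2 * i)))" by (simp add: h_odd)
    have b: "h k \<in> {f k, f k + 1}" and e: "even (f k)"
      using h_even[of "Suc i"] ev[of "Suc i"] 3 by simp_all
    show ?thesis
    proof (cases "h k = f k")
      case True
      then have "even (u k)" using e 3 by (simp add: u_def)
      then show ?thesis using True by (simp add: lower_even u_def)
    next
      case False
      then have h: "h k = f k + 1" using b by simp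
      then have "\<not> pinned u (Suc (2 * i))"
        using e ho 3 by (auto simp: pinned_def u_def)
      then show ?thesis using h 3 by (simp add: lower_Suc u_def)
    qed
  qed
  then show ?thesis by (simp add: u_def[abs_def] h_def)
qed

text \<open>At a positive even position the left neighbour of the tilted sequence is odd, so odd
  values are never pinned. Hence the D-collapse rounds down to even values here, and its result is
  special.\<close>

lemma even_lower_add:
  assumes f0: "f 0 = 0" and ev: "\<And>i. even (f (Suc (2 * i)))"
  shows "lower (\<lambda>k. f k + int k) (2 * i) - int (2 * i) =
    (if even (f (2 * i)) then f (2 * i) else f (2 * i) - 1)"
proof (cases i)
  case 0
  then show ?thesis by (simp add: f0)
next
  case (Suc j)
  then show ?thesis
    using ev[of j] by (auto simp: lower_Suc pinned_def)
qed

text \<open>Conversely, \<open>d_SP\<close> undoes the D-collapse of a metaplectic special diagram.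
  Moving the box restores the values that the D-collapse lowered. Other values are raised by 1
  unless capped at \<open>N\<close>, and the C-collapse takes these back.\<close>

lemma lower_shift_box_lower:
  assumes f0: "f 0 = 0" and conc: "concave f" and f_le: "\<And>k. f k \<le> N" and N: "even N"
    and ev: "\<And>i. even (f (Suc (2 * i)))" and pin: "\<And>k. pinned f k"
  shows "lower (shift_box N (\<lambda>k. lower (\<lambda>k. f k + int k) k - int k)) k = f k"
proof -
  define u where "u k = f k + int k" for k
  define e where "e k = lower u k - int k" for k
  define g where "g = shift_box N e"
  have e_even: "e (2 * i) = (if even (f (2 * i)) then f (2 * i) else f (2 * i) - 1)" for i
    using even_lower_add[OF f0 ev] by (simp add: e_def u_def[abs_def])
  have pin_u: "pinned u (2 * i) \<longleftrightarrow>
      even (f (2 * i)) \<and> f (2 * i) + f (Suc (Suc (2 * i))) = 2 * f (Suc (2 * i))" for i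
    using ev[of i] by (simp add: pinned_def u_def)
  have e_odd: "e (Suc (2 * i)) =
      (if pinned u (2 * i) then f (Suc (2 * i)) else f (Suc (2 * i)) - 1)" for i
    by (simp add: e_def lower_Suc u_def)
  have g: "g (Suc k) = min N (e (Suc k) + 1)" for k by (simp add: g_def shift_box_def)
  have "lower g k = f k"
  proof (cases k rule: nat_parity_cases)
    case 1
    then show ?thesis by (simp add: g_def shift_box_def f0)
  next
    case (2 i)
    show ?thesis
    proof (cases "pinned u (2 * i) \<and> f k \<noteq> N")
      case False
      then have "g k = f k" using f_le[of k] by (auto simp: 2 g e_odd)
      then show ?thesis using ev[of i] 2 by (simp add: lower_even)
    next
      case True
      then have p: "even (f (2 * i))" "f (2 * i) + f (Suc (Suc (2 * i))) = 2 * f k"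
        by (auto simp: pin_u 2)
      then have "even (f (Suc (Suc (2 * i))))" by (rule even_if_add_eq)
      then have "e (2 * i) = f (2 * i)" "e (Suc (Suc (2 * i))) = f (Suc (Suc (2 * i)))"
        using p(1) e_even[of i] e_even[of "Suc i"] by simp_all
      then have le: "g (2 * i) \<le> f (2 * i) + 1" "g (Suc (Suc (2 * i))) \<le> f (Suc (Suc (2 * i))) + 1"
        using f0 by (auto simp: g_def shift_box_def)
      have gk: "g k = f k + 1" using True f_le[of k] by (simp add: 2 g e_odd)
      have "\<not> pinned g (2 * i)"
      proof
        assume "pinned g (2 * i)"
        then have "even (g (2 * i))" "g (2 * i) + g (Suc (Suc (2 * i))) = 2 * f k + 2"
          using gk ev[of i] 2 by (auto simp: pinned_def)
        then have "g (2 * i) = f (2 * i) + 1" using p le by linarith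
        then show False using p \<open>even (g (2 * i))\<close> by simp
      qed
      then show ?thesis using gk 2 by (simp add: lower_Suc)
    qed
  next
    case (3 i)
    have ek: "e k = (if even (f k) then f k else f k - 1)" using e_even[of "Suc i"] 3 by simp
    show ?thesis
    proof (cases "even (f k)")
      case False
      have gk: "g k = f k" using f_le[of k] ek False g[of "Suc (2 * i)"] 3 by simp
      \<comment> \<open>An odd value of \<open>f\<close> is a midpoint by type C. It also unpins
        \<open>u\<close> at both adjacent odd positions, so \<open>g\<close> agrees with
        \<open>f\<close> at all three places and keeps the midpoint.\<close>
      have s: "f (Suc (2 * i)) + f (Suc (Suc (Suc (2 * i)))) = 2 * f k"
        using pin[of "Suc (2 * i)"] False 3 by (simp add: pinned_def)
      have "\<not> pinned u (2 * i)"
      proof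
        assume "pinned u (2 * i)"
        then have "even (f (Suc (Suc (2 * i))))" unfolding pin_u using even_if_add_eq by blast
        then show False using False 3 by simp
      qed
      then have "g (Suc (2 * i)) = f (Suc (2 * i))"
        using f_le[of "Suc (2 * i)"] by (simp add: g e_odd)
      moreover have "\<not> pinned u (2 * Suc i)"
        unfolding pin_u using False 3 by simp
      then have "g (Suc (Suc (Suc (2 * i)))) = f (Suc (Suc (Suc (2 * i))))"
        using f_le[of "Suc (2 * Suc i)"] e_odd[of "Suc i"] by (simp add: g)
      ultimately have "pinned g (Suc (2 * i))"
        using s ev[of i] gk 3 by (simp add: pinned_def)
      then show ?thesis using gk 3 by (simp add: lower_Suc)
    next
      case True
      show ?thesis
      proof (cases "f k = N")
        case True
        then have "g k = N" using ek N g[of "Suc (2 * i)"] 3 by simp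
        then show ?thesis using True N by (simp add: lower_even)
      next
        case False
        then have gk: "g k = f k + 1"
          using f_le[of k] ek \<open>even (f k)\<close> g[of "Suc (2 * i)"] 3 by simp
        have go: "g (Suc (2 * j)) \<le> f (Suc (2 * j)) + 1" for j
          by (auto simp: g e_odd)
        have "\<not> pinned g (Suc (2 * i))"
        proof
          assume "pinned g (Suc (2 * i))"
          then have "even (g (Suc (2 * i)))" "g (Suc (2 * i)) + g (Suc (2 * Suc i)) = 2 * f k + 2"
            using gk True 3 by (auto simp: pinned_def)
          moreover have "f (Suc (2 * i)) + f (Suc (2 * Suc i)) \<le> 2 * f k"
            using concaveD[OF conc, of "Suc (2 * i)"] 3 by simp
          ultimately have "g (Suc (2 * i)) = f (Suc (2 * i)) + 1"
            using go[of i] go[of "Suc i"] by linarith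
          then show False using ev[of i] \<open>even (g (Suc (2 * i)))\<close> by simp
        qed
        then show ?thesis using gk 3 by (simp add: lower_Suc)
      qed
    qed
  qed
  then show ?thesis by (simp add: g_def e_def[abs_def] u_def[abs_def])
qed

section \<open>The two maps on nilpotent orbits\<close>

lemma even_D_collapse:
  assumes "young_diagram d" "even (sum_list d)" "even (partial_sum d (2 * i))"
  shows "partial_sum (D_collapse d) (2 * i) = partial_sum d (2 * i)"
  using assms(3) by (simp add: D_collapse(2)[OF assms(1,2)] lower_even)

lemma Nil_o_special_iff:
  "d \<in> Nil_o_special n \<longleftrightarrow>
     type_D d \<and> sum_list d = 2 * n \<and> (\<forall>i. even (partial_sum d (2 * i)))"
proof -
  have "type_C (yd_transpose d) \<longleftrightarrow> (\<forall>i. even (partial_sum d (2 * i)))"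
    if "type_D d" "sum_list d = 2 * n"
    using that by (intro type_C_transpose_iff) (auto simp: type_D_def)
  then show ?thesis by (auto simp: Nil_o_special_def Nil_o_def)
qed

lemma Nil_sp_metaplectic_special_iff:
  "d \<in> Nil_sp_metaplectic_special n \<longleftrightarrow>
     type_C d \<and> sum_list d = 2 * n \<and> (\<forall>i. even (partial_sum d (Suc (2 * i))))"
proof -
  have "type_D (yd_transpose d) \<longleftrightarrow> (\<forall>i. even (partial_sum d (Suc (2 * i))))"
    if "type_C d" "sum_list d = 2 * n"
    using that by (intro type_D_transpose_iff) (auto simp: type_C_def)
  then show ?thesis by (auto simp: Nil_sp_metaplectic_special_def Nil_sp_def)
qed

lemma d_LS_collapse:
  assumes "d \<in> Nil_sp n"
  shows "is_collapse type_D (yd_transpose d) (d_LS d)"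
  using assms unfolding d_LS_def
  by (intro D_collapse)
     (auto simp: Nil_sp_def type_C_def young_diagram_transpose sum_list_transpose)

lemma d_LS_special:
  assumes "d \<in> Nil_sp n"
  shows "d_LS d \<in> Nil_o_special n"
proof -
  let ?e = "yd_transpose d"
  have d: "type_C d" "young_diagram d" "sum_list d = 2 * n"
    using assms by (auto simp: Nil_sp_def type_C_def)
  then have e: "young_diagram ?e" "sum_list ?e = 2 * n"
    by (auto simp: young_diagram_transpose sum_list_transpose)
  \<comment> \<open>The criterion is applied to \<open>?e\<close>, whose transpose is the type C
    diagram \<open>d\<close>.\<close>
  have "even (partial_sum ?e (2 * i))" for i
    using type_C_transpose_iff[of ?e] e d by (simp add: transpose_transpose)
  then show ?thesis
    using d_LS_collapse[OF assms] e
    by (auto simp: Nil_o_special_iff is_collapse_def dominated_def d_LS_def even_D_collapse)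
qed

text \<open>Surjectivity: the transpose of a special diagram is of type C by definition, and
  transposing back gives a type D diagram, which the collapse fixes.\<close>

lemma d_LS_transpose:
  assumes "d \<in> Nil_o_special n"
  shows "yd_transpose d \<in> Nil_sp n" "d_LS (yd_transpose d) = d"
  using assms
  by (auto simp: Nil_o_special_def Nil_o_def Nil_sp_def d_LS_def type_D_def transpose_transpose
      sum_list_transpose D_collapse_type_D)

lemma d_SP_collapse:
  assumes "d \<in> Nil_o_special n"
  shows "is_collapse type_C (remove_box_last (add_box_first d)) (d_SP d)"
    and "partial_sum (d_SP d) = lower (shift_box (2 * int n) (partial_sum d))"
    and "sum_list (d_SP d) = 2 * n"
proof -
  have d: "young_diagram d" "sum_list d = 2 * n"
    using assms by (auto simp: Nil_o_special_iff type_D_def)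
  show c: "is_collapse type_C (remove_box_last (add_box_first d)) (d_SP d)"
    unfolding d_SP_def using d by (intro C_collapse) (auto simp: remove_box_last_add_box_first)
  show "partial_sum (d_SP d) = lower (shift_box (2 * int n) (partial_sum d))"
    unfolding d_SP_def using d
    by (auto simp: fun_eq_iff C_collapse(2) remove_box_last_add_box_first)
  show "sum_list (d_SP d) = 2 * n"
    using c d by (auto simp: is_collapse_def dominated_def remove_box_last_add_box_first)
qed

lemma partial_sum_le_sum:
  "sum_list d = 2 * n \<Longrightarrow> partial_sum d k \<le> 2 * int n"
  using partial_sum_le[of d k] by simp

lemma d_SP_metaplectic_special:
  assumes "d \<in> Nil_o_special n"
  shows "d_SP d \<in> Nil_sp_metaplectic_special n" and "D_collapse (d_SP d) = d"
proof -
  have d: "type_D d" "young_diagram d" "sum_list d = 2 * n" "\<And>i. even (partial_sum d (2 * i))"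
    using assms by (auto simp: Nil_o_special_iff type_D_def)
  have C: "type_C (d_SP d)"
    using d_SP_collapse(1)[OF assms] by (simp add: is_collapse_def)
  then have y: "young_diagram (d_SP d)" by (simp add: type_C_def)
  have "even (2 * int n)" by simp
  note N = partial_sum_le_sum[OF d(3)] this
  note pin = pinned_type_D[OF d(1)]
  show "d_SP d \<in> Nil_sp_metaplectic_special n"
    unfolding Nil_sp_metaplectic_special_iff d_SP_collapse(2)[OF assms]
    using C d_SP_collapse(3)[OF assms] special_lower_shift_box(1)[OF partial_sum_0 N d(4) pin] by simp
  \<comment> \<open>The concavity required of the lowered sequence holds because it is the
    partial-sum function of the diagram \<open>d_SP d\<close>.\<close>
  have "partial_sum (D_collapse (d_SP d)) k = partial_sum d k" for k
    using D_collapse(2)[OF y] concave_partial_sum[OF y]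
      lower_lower_shift_box[OF partial_sum_0 concave_partial_sum[OF d(2)] N d(4) pin]
    by (simp add: d_SP_collapse(2,3)[OF assms])
  moreover have "young_diagram (D_collapse (d_SP d))"
    using D_collapse(1)[OF y] by (simp add: d_SP_collapse(3)[OF assms] is_collapse_def type_D_def)
  ultimately show "D_collapse (d_SP d) = d"
    using d(2) by (intro young_diagram_eqI_partial_sum)
qed

lemma D_collapse_metaplectic_special:
  assumes "d \<in> Nil_sp_metaplectic_special n"
  shows "D_collapse d \<in> Nil_o_special n" and "d_SP (D_collapse d) = d"
proof -
  have d: "type_C d" "young_diagram d" "sum_list d = 2 * n" "\<And>i. even (partial_sum d (Suc (2 * i)))"
    using assms by (auto simp: Nil_sp_metaplectic_special_iff type_C_def)
  have ps: "partial_sum (D_collapse d) = (\<lambda>k. lower (\<lambda>k. partial_sum d k + int k) k - int k)"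
    using d by (auto simp: D_collapse(2))
  have c: "is_collapse type_D d (D_collapse d)" using d by (simp add: D_collapse(1))
  have "even (partial_sum (D_collapse d) (2 * i))" for i
    unfolding ps using even_lower_add[OF partial_sum_0 d(4)] by simp
  then show s: "D_collapse d \<in> Nil_o_special n"
    using c d(3) by (simp add: Nil_o_special_iff is_collapse_def dominated_def)
  have "partial_sum (d_SP (D_collapse d)) k = partial_sum d k" for k
    unfolding d_SP_collapse(2)[OF s] ps
    using lower_shift_box_lower[OF partial_sum_0 concave_partial_sum[OF d(2)]
        partial_sum_le_sum[OF d(3)] _ d(4) pinned_type_C[OF d(1)]] by simp
  moreover have "young_diagram (d_SP (D_collapse d))"
    using d_SP_metaplectic_special(1)[OF s]
    by (simp add: Nil_sp_metaplectic_special_iff type_C_def)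
  ultimately show "d_SP (D_collapse d) = d"
    using d(2) by (intro young_diagram_eqI_partial_sum)
qed

lemma d_LS_antimono:
  assumes "c \<in> Nil_sp n" "d \<in> Nil_sp n" "c \<unlhd> d"
  shows "d_LS d \<unlhd> d_LS c"
  using collapse_mono[OF d_LS_collapse[OF assms(2)] d_LS_collapse[OF assms(1)]] assms
  by (simp add: transpose_antimono Nil_sp_def type_C_def)

lemma d_SP_mono:
  assumes "c \<in> Nil_o_special n" "d \<in> Nil_o_special n" "c \<unlhd> d"
  shows "d_SP c \<unlhd> d_SP d"
proof (rule collapse_mono[OF d_SP_collapse(1)[OF assms(1)] d_SP_collapse(1)[OF assms(2)]])
  have "young_diagram c" "young_diagram d"
    using assms by (auto simp: Nil_o_special_iff type_D_def)
  \<comment> \<open>Both diagrams have the same size, so \<open>shift_box\<close> caps them at the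
    same bound and preserves the pointwise order.\<close>
  then show "remove_box_last (add_box_first c) \<unlhd> remove_box_last (add_box_first d)"
    using assms(3)
    by (auto simp: dominated_iff remove_box_last_add_box_first shift_box_def min_le_iff_disj)
qed

theorem proposition1p3:
  fixes n :: nat
  shows
    "((\<forall>d \<in> Nil_sp n. \<exists>!c. is_collapse type_D (yd_transpose d) c) \<and>
      (\<forall>d \<in> Nil_sp n. d_LS d \<in> Nil_o_special n) \<and>
      d_LS ` Nil_sp n = Nil_o_special n \<and>
      monotone_on (Nil_sp n) (\<unlhd>) (\<lambda>c d. d \<unlhd> c) d_LS)
     \<and>
     ((\<forall>d \<in> Nil_o_special n. \<exists>!c. is_collapse type_C (remove_box_last (add_box_first d)) c) \<and>
      (\<forall>d \<in> Nil_o_special n. d_SP d \<in> Nil_sp_metaplectic_special n) \<and>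
      bij_betw d_SP (Nil_o_special n) (Nil_sp_metaplectic_special n) \<and>
      monotone_on (Nil_o_special n) (\<unlhd>) (\<unlhd>) d_SP)"
proof (intro conjI ballI)
  show "\<exists>!c. is_collapse type_D (yd_transpose d) c" if "d \<in> Nil_sp n" for d
    using d_LS_collapse[OF that] collapse_unique[of type_D, OF type_D_imp_young_diagram] by blast
  show "d_LS ` Nil_sp n = Nil_o_special n"
    by (auto simp: d_LS_special) (metis d_LS_transpose image_eqI)
  show "\<exists>!c. is_collapse type_C (remove_box_last (add_box_first d)) c"
    if "d \<in> Nil_o_special n" for d
    using d_SP_collapse(1)[OF that] collapse_unique[of type_C, OF type_C_imp_young_diagram] by blast
  show "bij_betw d_SP (Nil_o_special n) (Nil_sp_metaplectic_special n)"
    by (rule bij_betw_byWitness[where f' = D_collapse])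
       (auto simp: d_SP_metaplectic_special D_collapse_metaplectic_special)
qed (auto simp: d_LS_special d_SP_metaplectic_special monotone_on_def
      intro: d_LS_antimono d_SP_mono)

end
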